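(* Let $\sigma>0$ and let $x_1,\dots,x_N\in\mathbb{R}^n$ be $s$-sparse. Let $W_{i,j}=e^{-\frac{\|x_i-x_j\|_2^2}{2\sigma}}$ and $A=D^{-1/2}WD^{-1/2}$, where $D$ is the diagonal matrix with $D_{i,i}=\sum_{l=1}^N W_{i,l}$. Let $\Phi$ be an $m\times n$ matrix, let $\tilde W_{i,j}=e^{-\frac{\|\Phi x_i-\Phi x_j\|_2^2}{2\sigma}}$ and $\tilde A=\tilde D^{-1/2}\tilde W\tilde D^{-1/2}$, where $\tilde D$ is the diagonal matrix with $\tilde D_{i,i}=\sum_{l=1}^N\tilde W_{i,l}$. Let $0<\epsilon<1$ and suppose $\Phi$ satisfies the restricted isometry property with parameters $(2s,\delta)$, where $$\delta=\frac{\epsilon}{4\max_{i,j}\left\{\frac{\|x_i-x_j\|_2^2}{2\sigma}\right\}} .$$ Then for all $i,j\in\{1,\dots,N\}$ $$|\tilde A_{i,j}-A_{i,j}|\le\epsilon .$$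
   Context: A vector is $r$-sparse if it has at most $r$ nonzero entries. A matrix $\Phi\in\mathbb{R}^{m\times n}$ satisfies the restricted isometry property (RIP) with parameters $(r,\delta)$, where $\delta\in(0,1)$, if $(1-\delta)\|x\|_2\le\|\Phi x\|_2\le(1+\delta)\|x\|_2$ holds for all $r$-sparse vectors $x\in\mathbb{R}^n$. *)

theory Defs
  imports "HOL-Analysis.Analysis"
begin

definition sparse_vec :: "nat \<Rightarrow> real ^ 'n \<Rightarrow> bool" where
  "sparse_vec r v \<longleftrightarrow> card {k. v $ k \<noteq> 0} \<le> r"

text \<open>The norms below are Euclidean and are not squared. The range condition on \<open>\<delta>\<close> is
  part of the property.\<close>

definition restricted_isometry :: "nat \<Rightarrow> real \<Rightarrow> real ^ 'n ^ 'm \<Rightarrow> bool" where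
  "restricted_isometry r \<delta> \<Phi> \<longleftrightarrow> 0 < \<delta> \<and> \<delta> < 1 \<and>
     (\<forall>v. sparse_vec r v \<longrightarrow>
        (1 - \<delta>) * norm v \<le> norm (\<Phi> *v v) \<and> norm (\<Phi> *v v) \<le> (1 + \<delta>) * norm v)"

definition gaussian_weights :: "real \<Rightarrow> ('k::finite \<Rightarrow> real ^ 'd) \<Rightarrow> real ^ 'k ^ 'k" where
  "gaussian_weights \<sigma> y = (\<chi> i j. exp (- ((norm (y i - y j))\<^sup>2 / (2 * \<sigma>))))"

definition degree_matrix :: "real ^ 'k ^ 'k \<Rightarrow> real ^ 'k ^ ('k::finite)" where
  "degree_matrix W = (\<chi> i j. if i = j then (\<Sum>l\<in>UNIV. W $ i $ l) else 0)"

text \<open>The power \<open>D\<^sup>-\<^sup>1\<^sup>/\<^sup>2\<close>, meant only for diagonal \<open>D\<close> with positive diagonal entries.\<close>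

definition diag_inv_sqrt :: "real ^ 'k ^ 'k \<Rightarrow> real ^ 'k ^ ('k::finite)" where
  "diag_inv_sqrt D = (\<chi> i j. if i = j then (D $ i $ i) powr (- 1 / 2) else 0)"

definition normalized_affinity :: "real \<Rightarrow> ('k::finite \<Rightarrow> real ^ 'd) \<Rightarrow> real ^ 'k ^ 'k" where
  "normalized_affinity \<sigma> y =
     (let W = gaussian_weights \<sigma> y; D = degree_matrix W
      in diag_inv_sqrt D ** W ** diag_inv_sqrt D)"

end

theory Submission imports Defs begin

text \<open>
  The Gaussian weights are \<open>exp (- a i j)\<close> with exponents \<open>a i j = \<parallel>x\<^sub>i - x\<^sub>j\<parallel>\<^sup>2 / (2 \<sigma>)\<close>. Two facts
  give the theorem.

  The map from the exponents to the normalised entries is \<open>1\<close>-Lipschitz in the supremum norm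
  (\<open>normalized_kernel_lipschitz\<close>). If all exponents move by at most \<open>c\<close>, every weight and every
  degree changes by a factor between \<open>exp (- c)\<close> and \<open>exp c\<close>. Off the diagonal an entry therefore
  changes by a factor within \<open>exp (\<plusminus> 2 c)\<close>; but such an entry is at most \<open>1 / 2\<close>, because each of the
  two degrees involved contains the entry's own weight as well as the weight \<open>1\<close> of the diagonal.
  On the diagonal the weight is constantly \<open>1\<close>, so only the degree contributes and the factor is
  within \<open>exp (\<plusminus> c)\<close>, while the entry is at most \<open>1\<close>. As \<open>1 - exp (- t) \<le> t\<close>, the additive change is
  at most \<open>c\<close> in both cases.

  The exponents of the compressed points differ from the original ones by at most \<open>3 \<epsilon> / 4\<close>
  (\<open>restricted_isometry_square\<close>): a difference of two \<open>s\<close>-sparse vectors is \<open>2 s\<close>-sparse, so squaring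
  the isometry bounds changes \<open>a i j\<close> by at most \<open>(2 \<delta> + \<delta>\<^sup>2) a i j \<le> 3 \<delta> a i j\<close>, and
  \<open>\<delta> a i j \<le> \<epsilon> / 4\<close> by the choice of \<open>\<delta>\<close>.
\<close>

definition kernel_degree :: "('k::finite \<Rightarrow> 'k \<Rightarrow> real) \<Rightarrow> 'k \<Rightarrow> real" where
  "kernel_degree a i = (\<Sum>l\<in>UNIV. exp (- a i l))"

definition normalized_kernel :: "('k::finite \<Rightarrow> 'k \<Rightarrow> real) \<Rightarrow> 'k \<Rightarrow> 'k \<Rightarrow> real" where
  "normalized_kernel a i j = exp (- a i j) / sqrt (kernel_degree a i * kernel_degree a j)"

lemma kernel_degree_pos: "0 < kernel_degree a i"
  unfolding kernel_degree_def by (intro sum_pos) auto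

lemma diag_mult_nth_mult_diag:
  fixes A :: "real ^ 'k ^ ('k::finite)"
  shows "((\<chi> i j. if i = j then u i else 0) ** A ** (\<chi> i j. if i = j then v i else 0)) $ i $ j
    = u i * A $ i $ j * v j"
  by (simp add: matrix_matrix_mult_def if_distrib if_distribR cong: if_cong)

lemma normalized_affinity_eq_normalized_kernel:
  "normalized_affinity \<sigma> y $ i $ j
     = normalized_kernel (\<lambda>i j. (norm (y i - y j))\<^sup>2 / (2 * \<sigma>)) i j"
proof -
  define a where "a = (\<lambda>i j. (norm (y i - y j))\<^sup>2 / (2 * \<sigma>))"
  have deg: "degree_matrix (gaussian_weights \<sigma> y) $ k $ k = kernel_degree a k" for k
    by (simp add: degree_matrix_def gaussian_weights_def kernel_degree_def a_def)
  have powr: "t powr - (1 / 2) = 1 / sqrt t" if "0 < t" for t :: real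
    using that by (simp add: powr_minus_divide powr_half_sqrt)
  show ?thesis
    unfolding normalized_affinity_def Let_def diag_inv_sqrt_def diag_mult_nth_mult_diag deg
    by (simp add: powr kernel_degree_pos normalized_kernel_def real_sqrt_mult
        gaussian_weights_def flip: a_def) (simp add: a_def)
qed

lemma kernel_degree_le_exp_mult:
  assumes "\<And>i j. \<bar>a i j - b i j\<bar> \<le> c"
  shows "kernel_degree b i \<le> exp c * kernel_degree a i"
  unfolding kernel_degree_def sum_distrib_left
proof (rule sum_mono)
  fix l
  show "exp (- b i l) \<le> exp c * exp (- a i l)"
    using assms[of i l] by (simp flip: exp_add)
qed

text \<open>The exponent of the entry itself gets its own bound \<open>d\<close>, since on the diagonal it does not move
  at all. The two square roots of degrees together cost one more factor \<open>exp c\<close>.\<close>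

lemma normalized_kernel_le_exp_mult:
  assumes "\<And>i j. \<bar>a i j - b i j\<bar> \<le> c" and "\<bar>a i j - b i j\<bar> \<le> d"
  shows "normalized_kernel a i j \<le> exp (d + c) * normalized_kernel b i j"
proof -
  have "kernel_degree b i * kernel_degree b j
      \<le> (exp c * kernel_degree a i) * (exp c * kernel_degree a j)"
    by (intro mult_mono kernel_degree_le_exp_mult assms(1))
       (simp_all add: kernel_degree_pos less_imp_le)
  also have "\<dots> = (exp c)\<^sup>2 * (kernel_degree a i * kernel_degree a j)"
    by (simp add: power2_eq_square)
  finally have "sqrt (kernel_degree b i * kernel_degree b j)
      \<le> exp c * sqrt (kernel_degree a i * kernel_degree a j)"
    by (metis real_sqrt_le_mono real_sqrt_mult real_sqrt_abs abs_exp_cancel)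
  moreover have "exp (- a i j) \<le> exp d * exp (- b i j)"
    using assms(2) by (simp flip: exp_add)
  ultimately have "exp (- a i j) * sqrt (kernel_degree b i * kernel_degree b j)
      \<le> (exp d * exp (- b i j)) * (exp c * sqrt (kernel_degree a i * kernel_degree a j))"
    by (intro mult_mono) (simp_all add: kernel_degree_pos less_imp_le)
  then show ?thesis
    by (simp add: normalized_kernel_def field_simps exp_add kernel_degree_pos)
qed

lemma normalized_kernel_le:
  assumes "0 < m" "m \<le> kernel_degree a i" "m \<le> kernel_degree a j"
  shows "normalized_kernel a i j \<le> exp (- a i j) / m"
proof -
  have "sqrt (m * m) \<le> sqrt (kernel_degree a i * kernel_degree a j)"
    using assms by (intro real_sqrt_le_mono mult_mono) auto
  then show ?thesis
    unfolding normalized_kernel_def using assms(1)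
    by (intro divide_left_mono) (auto simp: kernel_degree_pos)
qed

lemma normalized_kernel_diag_le_one: "normalized_kernel a i i \<le> 1"
proof -
  have "exp (- a i i) \<le> kernel_degree a i"
    unfolding kernel_degree_def by (rule member_le_sum) auto
  then show ?thesis
    using normalized_kernel_le[of "exp (- a i i)" a i i] by simp
qed

text \<open>With \<open>w = exp (- a i j) \<le> 1\<close>, both degrees are at least \<open>1 + w\<close>, and \<open>w / (1 + w) \<le> 1 / 2\<close>.\<close>

lemma normalized_kernel_off_diag_le_half:
  assumes "i \<noteq> j" "a i i = 0" "a j j = 0" "a j i = a i j" "0 \<le> a i j"
  shows "normalized_kernel a i j \<le> 1 / 2"
proof -
  have deg: "(\<Sum>l\<in>{i, j}. exp (- a k l)) \<le> kernel_degree a k" for k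
    unfolding kernel_degree_def by (intro sum_mono2) auto
  have "normalized_kernel a i j \<le> exp (- a i j) / (1 + exp (- a i j))"
    using deg[of i] deg[of j] assms
    by (intro normalized_kernel_le) (simp_all add: add_pos_pos)
  also have "\<dots> \<le> 1 / 2"
    using assms(5) by (simp add: field_simps add_pos_pos)
  finally show ?thesis .
qed

lemma abs_diff_le_of_exp_ratio:
  fixes p q h t :: real
  assumes "p \<le> exp t * q" "q \<le> exp t * p" "p \<le> h" "q \<le> h" "0 \<le> h" "0 \<le> t"
  shows "\<bar>p - q\<bar> \<le> h * t"
proof -
  have "u - v \<le> h * t" if "u \<le> exp t * v" "u \<le> h" for u v :: real
  proof -
    have "exp (- t) * u \<le> v"
      using that(1) by (simp add: exp_minus field_simps)
    then have "u - v \<le> u * (1 - exp (- t))"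
      by (simp add: algebra_simps)
    also have "\<dots> \<le> h * (1 - exp (- t))"
      using that(2) assms(6) by (intro mult_right_mono) auto
    also have "\<dots> \<le> h * t"
      using exp_ge_add_one_self[of "- t"] assms(5) by (intro mult_left_mono) auto
    finally show ?thesis .
  qed
  from this[of p q] this[of q p] show ?thesis
    using assms by auto
qed

text \<open>The product of the size of an entry and the logarithm of its possible change is
  \<open>(1 / 2) \<cdot> 2 c\<close> off the diagonal and \<open>1 \<cdot> c\<close> on it.\<close>

theorem normalized_kernel_lipschitz:
  assumes "\<And>i. a i i = 0" "\<And>i j. a j i = a i j" "\<And>i j. 0 \<le> a i j"
    and "\<And>i. b i i = 0" "\<And>i j. b j i = b i j" "\<And>i j. 0 \<le> b i j"
    and close: "\<And>i j. \<bar>a i j - b i j\<bar> \<le> c"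
  shows "\<bar>normalized_kernel a i j - normalized_kernel b i j\<bar> \<le> c"
proof -
  have close': "\<bar>b i j - a i j\<bar> \<le> c" for i j
    using close[of i j] by linarith
  have c: "0 \<le> c"
    using close[of i j] by linarith
  show ?thesis
  proof (cases "i = j")
    case True
    have "\<bar>normalized_kernel a i i - normalized_kernel b i i\<bar> \<le> 1 * (0 + c)"
      using c assms(1,4)
      by (intro abs_diff_le_of_exp_ratio normalized_kernel_le_exp_mult
          normalized_kernel_diag_le_one close close') auto
    with True show ?thesis by simp
  next
    case False
    have "\<bar>normalized_kernel a i j - normalized_kernel b i j\<bar> \<le> 1 / 2 * (c + c)"
      using c False assms(1-6)
      by (intro abs_diff_le_of_exp_ratio normalized_kernel_le_exp_mult
          normalized_kernel_off_diag_le_half close close') auto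
    then show ?thesis by simp
  qed
qed

lemma sparse_vec_diff:
  fixes v w :: "real ^ 'n"
  assumes "sparse_vec r v" "sparse_vec s w"
  shows "sparse_vec (r + s) (v - w)"
proof -
  have "card {k. (v - w) $ k \<noteq> 0} \<le> card ({k. v $ k \<noteq> 0} \<union> {k. w $ k \<noteq> 0})"
    by (intro card_mono) auto
  also have "\<dots> \<le> card {k. v $ k \<noteq> 0} + card {k. w $ k \<noteq> 0}"
    by (rule card_Un_le)
  finally show ?thesis
    using assms unfolding sparse_vec_def by linarith
qed

lemma restricted_isometry_square:
  assumes "restricted_isometry r \<delta> \<Phi>" "sparse_vec r v"
  shows "\<bar>(norm (\<Phi> *v v))\<^sup>2 - (norm v)\<^sup>2\<bar> \<le> 3 * \<delta> * (norm v)\<^sup>2"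
proof -
  have \<delta>: "0 < \<delta>" "\<delta> < 1"
    and low: "(1 - \<delta>) * norm v \<le> norm (\<Phi> *v v)"
    and up: "norm (\<Phi> *v v) \<le> (1 + \<delta>) * norm v"
    using assms by (auto simp: restricted_isometry_def)
  have "((1 - \<delta>) * norm v)\<^sup>2 \<le> (norm (\<Phi> *v v))\<^sup>2"
    using low \<delta> by (intro power_mono) auto
  moreover have "(norm (\<Phi> *v v))\<^sup>2 \<le> ((1 + \<delta>) * norm v)\<^sup>2"
    using up by (intro power_mono) auto
  moreover have "(1 - 3 * \<delta>) * (norm v)\<^sup>2 \<le> ((1 - \<delta>) * norm v)\<^sup>2"
    unfolding power_mult_distrib using \<delta>
    by (intro mult_right_mono) (auto simp: power2_eq_square algebra_simps)
  moreover have "((1 + \<delta>) * norm v)\<^sup>2 \<le> (1 + 3 * \<delta>) * (norm v)\<^sup>2"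
    unfolding power_mult_distrib using \<delta>
    by (intro mult_right_mono) (auto simp: power2_eq_square algebra_simps)
  ultimately show ?thesis
    by (simp add: algebra_simps abs_le_iff)
qed

theorem theorem8:
  fixes x :: "'k::finite \<Rightarrow> real ^ 'n"
    and \<Phi> :: "real ^ 'n ^ 'm"
    and \<sigma> \<epsilon> \<delta> :: real
    and s :: nat
  assumes "\<sigma> > 0"
    and "\<And>i. sparse_vec s (x i)"
    and "0 < \<epsilon>" and "\<epsilon> < 1"
    and "\<delta> = \<epsilon> / (4 * Max {(norm (x i - x j))\<^sup>2 / (2 * \<sigma>) | i j. True})"
    and "restricted_isometry (2 * s) \<delta> \<Phi>"
  shows "\<forall>i j. \<bar>normalized_affinity \<sigma> (\<lambda>l. \<Phi> *v x l) $ i $ j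
               - normalized_affinity \<sigma> x $ i $ j\<bar> \<le> \<epsilon>"
proof -
  define M where "M = Max {(norm (x i - x j))\<^sup>2 / (2 * \<sigma>) | i j. True}"
  define a where "a = (\<lambda>i j. (norm (x i - x j))\<^sup>2 / (2 * \<sigma>))"
  define b where "b = (\<lambda>i j. (norm (\<Phi> *v x i - \<Phi> *v x j))\<^sup>2 / (2 * \<sigma>))"
  have \<delta>: "0 < \<delta>" and \<delta>_eq: "\<delta> = \<epsilon> / (4 * M)"
    using assms(5,6) by (auto simp: restricted_isometry_def M_def)
  \<comment> \<open>If all points coincided, the quotient would be \<open>\<epsilon> / 0 = 0\<close>, which is not a valid \<open>\<delta>\<close>.\<close>
  have "M \<noteq> 0"
    using \<delta> \<delta>_eq by auto
  then have \<delta>M: "\<delta> * M = \<epsilon> / 4"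
    using \<delta>_eq by simp
  have "{(norm (x i - x j))\<^sup>2 / (2 * \<sigma>) | i j. True} = (\<lambda>(i, j). a i j) ` UNIV"
    by (auto simp: a_def)
  then have a_le: "a i j \<le> M" for i j
    unfolding M_def by (intro Max_ge) (auto simp: a_def)
  have close: "\<bar>b i j - a i j\<bar> \<le> 3 * \<epsilon> / 4" for i j
  proof -
    have "sparse_vec (2 * s) (x i - x j)"
      using sparse_vec_diff[OF assms(2) assms(2)] by (simp add: mult_2)
    from restricted_isometry_square[OF assms(6) this]
    have "\<bar>(norm (\<Phi> *v x i - \<Phi> *v x j))\<^sup>2 - (norm (x i - x j))\<^sup>2\<bar> / (2 * \<sigma>)
        \<le> 3 * \<delta> * (norm (x i - x j))\<^sup>2 / (2 * \<sigma>)"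
      using assms(1) by (intro divide_right_mono) (auto simp: matrix_vector_mult_diff_distrib)
    then have "\<bar>b i j - a i j\<bar> \<le> 3 * (\<delta> * a i j)"
      using assms(1) by (simp add: a_def b_def flip: diff_divide_distrib)
    also have "\<dots> \<le> 3 * (\<delta> * M)"
      using \<delta> a_le by simp
    finally show ?thesis
      using \<delta>M by simp
  qed
  have "\<bar>normalized_kernel b i j - normalized_kernel a i j\<bar> \<le> 3 * \<epsilon> / 4" for i j
    using assms(1)
    by (intro normalized_kernel_lipschitz close) (auto simp: a_def b_def norm_minus_commute)
  moreover have "3 * \<epsilon> / 4 \<le> \<epsilon>"
    using assms(3) by simp
  ultimately show ?thesis
    unfolding normalized_affinity_eq_normalized_kernel a_def b_def by (meson order_trans)
qed

end
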